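(* There is an absolute constant $C\in\mathbb{N}$ such that for every zonotope $Z\subseteq\mathbb{R}^d$ and every convex body $Q\subseteq\mathbb{R}^d$ with $Z\not\subseteq Q$, the Hypercube Sampling algorithm run with $T\ge d^{2C}$ iterations returns, with high probability, a point $x\in\big(O(\sqrt d)\cdot Z\big)\setminus Q$. Consequently, for $s(d)=O(\sqrt d)$, the Hypercube Sampling algorithm solves the $(Z,Q)$-Gap-Containment problem with high probability.
   Context: A zonotope is a set $Z(W)=\{Wx: x\in\mathbb{R}^n,\ \|x\|_\infty\le1\}$ with generator matrix $W\in\mathbb{R}^{d\times n}$; a convex body is a closed convex set with non-empty interior, and bodies are centered (contain the origin in their interior). The outer body $Q$ is accessed by a membership oracle answering whether a given point lies in $Q$. For a function $s(d)\ge 1$, an algorithm solves an instance $(K,Q)$ of Gap-Containment if it outputs Yes when $K\subseteq Q$ and outputs No when $s(d)\cdot K\not\subseteq Q$ (either answer is allowed if both hold). The Hypercube Sampling algorithm: first, using Talagrand's zonotope sparsification (computed by the randomized algorithm of Cohen and Peng), replace $Z$ by a zonotope $Z'=Z(W)$ with $W\in\mathbb{R}^{d\times n}$, $n=O(d\log d)$, such that $Z'\subseteq Z\subseteq 2Z'$; then for $T$ iterations sample $y\in\{\pm1\}^n$ uniformly at random and, if $x=2\sqrt{n/\log n}\cdot Wy\notin Q$ (checked with the membership oracle), return $x$ (answer No); if no such point is found after $T$ iterations, answer Yes. *)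

theory Defs
  imports
    "HOL-Probability.Probability"
    "HOL-Library.Landau_Symbols"
    "Jordan_Normal_Form.Matrix"
begin

text \<open>
  The dimension \<open>d\<close> and the number of generators vary inside the statement, so the space
  of \<open>d\<close>-dimensional real vectors is the carrier \<^term>\<open>carrier_vec d\<close>. Its topology is
  the one induced by the Euclidean distance.
\<close>

definition euclid_dist :: "nat \<Rightarrow> real vec \<Rightarrow> real vec \<Rightarrow> real" where
  "euclid_dist d x y = L2_set (\<lambda>i. x $ i - y $ i) {..<d}"

lemma Metric_space_euclid: "Metric_space (carrier_vec d) (euclid_dist d)"
proof
  fix x y z :: "real vec"
  show "0 \<le> euclid_dist d x y"
    by (simp add: euclid_dist_def)
  show "euclid_dist d x y = euclid_dist d y x"
    by (simp add: euclid_dist_def L2_set_def power2_commute)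
  show "euclid_dist d x y = 0 \<longleftrightarrow> x = y" if "x \<in> carrier_vec d" "y \<in> carrier_vec d"
    using that by (auto simp: euclid_dist_def L2_set_eq_0_iff)
  show "euclid_dist d x z \<le> euclid_dist d x y + euclid_dist d y z"
    using L2_set_triangle_ineq[of "\<lambda>i. x $ i - y $ i" "\<lambda>i. y $ i - z $ i" "{..<d}"]
    by (simp add: euclid_dist_def)
qed

definition euclid_top :: "nat \<Rightarrow> real vec topology" where
  "euclid_top d = Metric_space.mtopology (carrier_vec d) (euclid_dist d)"

definition convex_vecs :: "real vec set \<Rightarrow> bool" where
  "convex_vecs K \<longleftrightarrow>
     (\<forall>x\<in>K. \<forall>y\<in>K. \<forall>u\<ge>0. \<forall>v\<ge>0. u + v = 1 \<longrightarrow> u \<cdot>\<^sub>v x + v \<cdot>\<^sub>v y \<in> K)"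

text \<open>Convex bodies are closed but, in this convention, not required to be bounded.\<close>

definition convex_body :: "nat \<Rightarrow> real vec set \<Rightarrow> bool" where
  "convex_body d K \<longleftrightarrow>
     closedin (euclid_top d) K \<and> convex_vecs K \<and> euclid_top d interior_of K \<noteq> {}"

definition centered :: "nat \<Rightarrow> real vec set \<Rightarrow> bool" where
  "centered d K \<longleftrightarrow> 0\<^sub>v d \<in> euclid_top d interior_of K"

definition scale_set :: "real \<Rightarrow> real vec set \<Rightarrow> real vec set" where
  "scale_set r K = (\<lambda>x. r \<cdot>\<^sub>v x) ` K"

definition zonotope :: "real mat \<Rightarrow> real vec set" where
  "zonotope W = {W *\<^sub>v x | x. x \<in> carrier_vec (dim_col W) \<and> (\<forall>i<dim_col W. \<bar>x $ i\<bar> \<le> 1)}"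

text \<open>
  The requirement of at least two generators makes \<open>n / ln n\<close> in the sampling step
  meaningful. It holds automatically for full-dimensional zonotopes in dimension at least 2,
  and can otherwise be achieved by appending zero columns.
\<close>

definition is_sparsification :: "nat \<Rightarrow> nat \<Rightarrow> real mat \<Rightarrow> real mat \<Rightarrow> bool" where
  "is_sparsification d N V W \<longleftrightarrow>
     dim_row W = d \<and> 2 \<le> dim_col W \<and> dim_col W \<le> N \<and>
     zonotope W \<subseteq> zonotope V \<and> zonotope V \<subseteq> scale_set 2 (zonotope W)"

text \<open>
  The guarantee of the randomized sparsification subroutine, which the sampling algorithm calls
  as a black box. Its input is a generator matrix of the zonotope. ``With high probability'' means
  failure probability \<open>O(d\<^sup>-\<^sup>c)\<close>, uniformly over all zonotopes in dimension \<open>d\<close>.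
  The bound \<open>N d = O(d log d)\<close> is only asymptotic, as \<open>d log d\<close> vanishes for \<open>d = 1\<close>.
\<close>

definition zonotope_sparsifier ::
    "real \<Rightarrow> (nat \<Rightarrow> nat) \<Rightarrow> (real mat \<Rightarrow> real mat pmf) \<Rightarrow> bool" where
  "zonotope_sparsifier c N S \<longleftrightarrow>
     (\<lambda>d. real (N d)) \<in> O(\<lambda>d. real d * ln (real d)) \<and>
     (\<exists>\<delta> :: nat \<Rightarrow> real. \<delta> \<in> O(\<lambda>d. real d powr (- c)) \<and>
        (\<forall>d>0. \<forall>m. \<forall>V\<in>carrier_mat d m.
           measure_pmf.prob (S V) {W. is_sparsification d (N d) V W} \<ge> 1 - \<delta> d))"

datatype answer = Yes | No "real vec"

definition sign_vecs :: "nat \<Rightarrow> real vec set" where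
  "sign_vecs n = {y \<in> carrier_vec n. \<forall>i<n. y $ i \<in> {-1, 1}}"

lemma finite_sign_vecs: "finite (sign_vecs n)"
proof (rule finite_subset)
  show "sign_vecs n \<subseteq> vec n ` ({..<n} \<rightarrow>\<^sub>E {-1, 1})"
  proof
    fix y assume y: "y \<in> sign_vecs n"
    then have "y = vec n (\<lambda>i\<in>{..<n}. y $ i)"
      by (intro eq_vecI) (auto simp: sign_vecs_def)
    moreover have "(\<lambda>i\<in>{..<n}. y $ i) \<in> {..<n} \<rightarrow>\<^sub>E {-1, 1}"
      using y unfolding sign_vecs_def by (intro restrict_PiE_iff[THEN iffD2]) blast
    ultimately show "y \<in> vec n ` ({..<n} \<rightarrow>\<^sub>E {-1, 1})"
      by (rule image_eqI)
  qed
  show "finite (vec n ` ({..<n} \<rightarrow>\<^sub>E {- 1, 1 :: real}))"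
    by (intro finite_imageI finite_PiE) auto
qed

lemma sign_vecs_nonempty: "sign_vecs n \<noteq> {}"
proof -
  have "vec n (\<lambda>_. 1) \<in> sign_vecs n"
    by (simp add: sign_vecs_def)
  then show ?thesis
    by blast
qed

definition sample_point :: "real mat \<Rightarrow> real vec \<Rightarrow> real vec" where
  "sample_point W y = (2 * sqrt (real (dim_col W) / ln (real (dim_col W)))) \<cdot>\<^sub>v (W *\<^sub>v y)"

primrec sampling_loop :: "(real vec \<Rightarrow> bool) \<Rightarrow> real mat \<Rightarrow> nat \<Rightarrow> answer pmf" where
  "sampling_loop mem W 0 = return_pmf Yes"
| "sampling_loop mem W (Suc T) =
     bind_pmf (pmf_of_set (sign_vecs (dim_col W))) (\<lambda>y.
       let x = sample_point W y
       in if \<not> mem x then return_pmf (No x) else sampling_loop mem W T)"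

text \<open>Here \<open>S\<close> is the sparsification subroutine and \<open>mem\<close> the membership oracle.\<close>

definition hypercube_sampling ::
    "(real mat \<Rightarrow> real mat pmf) \<Rightarrow> (real vec \<Rightarrow> bool) \<Rightarrow> real mat \<Rightarrow> nat \<Rightarrow> answer pmf" where
  "hypercube_sampling S mem V T = bind_pmf (S V) (\<lambda>W. sampling_loop mem W T)"

text \<open>
  The first disjunct is the gap, where \<open>K \<subseteq> Q\<close> and \<open>\<not> s K \<subseteq> Q\<close> both hold and either answer is
  allowed.
\<close>

definition solves_gap_containment ::
    "real \<Rightarrow> real vec set \<Rightarrow> real vec set \<Rightarrow> answer \<Rightarrow> bool" where
  "solves_gap_containment s K Q a \<longleftrightarrow>
     (K \<subseteq> Q \<and> \<not> scale_set s K \<subseteq> Q) \<or>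
     ((K \<subseteq> Q \<longrightarrow> a = Yes) \<and> (\<not> scale_set s K \<subseteq> Q \<longrightarrow> (\<exists>x. a = No x)))"

end

theory Submission
  imports Defs "HOL-Real_Asymp.Real_Asymp"
begin

text \<open>
  Averaging over the cyclic shifts replaces any appeal to separating hyperplanes or
  anticoncentration of general Rademacher sums. By convexity some sign vector \<open>\<sigma>\<close> has
  \<open>2 W \<sigma> \<notin> Q\<close>. Given a set \<open>P\<close> of \<open>k\<close> coordinates, flip the signs of \<open>\<sigma>\<close> outside each of the
  \<open>n\<close> cyclic shifts of \<open>P\<close>; the resulting sign vectors average to \<open>((2 k - n) / n) \<sigma>\<close>. If
  \<open>2 k - n \<ge> sqrt (n ln n)\<close>, the corresponding sample points therefore average to
  \<open>\<lambda> 2 W \<sigma>\<close> for some \<open>\<lambda> \<ge> 1\<close>, which lies outside \<open>Q\<close> because \<open>0 \<in> Q\<close>, so one of them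
  lies outside \<open>Q\<close>. Hence at least a fraction \<open>1 / n\<close> of the binomial tail
  \<open>(n choose k) / 2 ^ n\<close>, which is polynomial in \<open>1 / n\<close>, consists of escaping samples.
\<close>

unbundle no vec_syntax

section \<open>Lower bounds for binomial coefficients near the centre\<close>

text \<open>Moving one step away from the middle costs a factor of at least
  \<open>(1 - x) / (1 + x)\<close> with \<open>x = 2 * j / n\<close>. The first assumption gives
  \<open>x \<le> 1/2\<close>, where this factor is at least \<open>exp (- 3 * x)\<close>;
  \<open>j\<close> such steps multiply to the stated exponential.\<close>

lemma binomial_step_lower:
  assumes "2 * j \<le> n div 2" "0 < n"
  shows "real (n choose (n div 2 + j)) \<ge> real (n choose (n div 2)) * exp (- 6 * (real j)\<^sup>2 / real n)"
proof -
  define h where "h = n div 2"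
  define x where "x = 2 * real j / real n"
  have hn: "real h \<le> real n / 2" "real n / 2 \<le> real n - real h" "h \<le> n"
    using assms unfolding h_def by linarith+
  have jn: "2 * real j \<le> real n / 2"
    using assms(1) hn(1) unfolding h_def by linarith
  have x: "0 \<le> x" "x \<le> 1/2"
    using jn assms(2) by (auto simp: x_def field_simps)
  have ratio: "exp (- 3 * x) \<le> (1 - x) / (1 + x)"
  proof -
    have "exp (- x) \<le> 1 / (1 + x)"
      using exp_ge_add_one_self[of x] x by (simp add: exp_minus field_simps)
    moreover have "exp (- 2 * x) \<le> 1 - x"
    proof -
      have "- x - 2 * x\<^sup>2 \<le> ln (1 - x)"
        using ln_one_minus_pos_lower_bound x by blast
      moreover have "2 * x\<^sup>2 \<le> x"
        using x mult_left_mono[of x "1/2" x] by (simp add: power2_eq_square)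
      ultimately have "- 2 * x \<le> ln (1 - x)"
        by linarith
      then show ?thesis
        using x by (simp add: ln_ge_iff)
    qed
    ultimately have "exp (- 2 * x) * exp (- x) \<le> (1 - x) * (1 / (1 + x))"
      using x by (intro mult_mono) auto
    then show ?thesis
      by (simp add: exp_add[symmetric])
  qed
  have "real (n choose (h + i)) \<ge> real (n choose h) * exp (- 3 * x) ^ i" if "i \<le> j" for i
    using that
  proof (induction i)
    case (Suc i)
    have "Suc (h + i) * (n choose Suc (h + i)) = (n - (h + i)) * (n choose (h + i))"
      by (metis binomial_absorb_comp binomial_absorption mult.commute)
    then have "real (Suc (h + i)) * real (n choose Suc (h + i)) = real (n - (h + i)) * real (n choose (h + i))"
      by (metis of_nat_mult)
    moreover have "h + i \<le> n"
      using Suc.prems hn jn by linarith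
    ultimately have eq: "real (n choose Suc (h + i)) = (real n - h - i) / (h + i + 1) * real (n choose (h + i))"
      by (simp add: field_simps of_nat_diff)
    have "(1 - x) / (1 + x) = (real n / 2 - j) / (real n / 2 + j)"
    proof -
      have "real j = x * (real n / 2)"
        using assms(2) by (simp add: x_def)
      then have "(1 - x) * (real n / 2 + j) = (real n / 2 - j) * (1 + x)"
        by (simp add: field_simps)
      then show ?thesis
        using assms(2) x by (subst frac_eq_eq) auto
    qed
    \<comment> \<open>Since \<open>Suc i \<le> j\<close>, the \<open>+ 1\<close> in the denominator
      is absorbed by \<open>j\<close>.\<close>
    also have "\<dots> \<le> (real n - h - i) / (h + i + 1)"
      using Suc.prems hn jn assms(2) by (intro frac_le) auto
    finally have "exp (- 3 * x) \<le> (real n - h - i) / (h + i + 1)"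
      using ratio by linarith
    moreover have "0 \<le> (real n - h - i) / (h + i + 1)"
      using \<open>h + i \<le> n\<close> by (auto simp flip: of_nat_add)
    ultimately have "exp (- 3 * x) * (real (n choose h) * exp (- 3 * x) ^ i)
        \<le> (real n - h - i) / (h + i + 1) * real (n choose (h + i))"
      using Suc.IH Suc.prems by (intro mult_mono) simp_all
    then show ?case
      by (simp add: eq mult_ac)
  qed simp
  from this[of j] have "real (n choose (h + j)) \<ge> real (n choose h) * exp (- 3 * x) ^ j"
    by simp
  also have "exp (- 3 * x) ^ j = exp (- 6 * (real j)\<^sup>2 / real n)"
    by (simp add: x_def exp_of_nat_mult[symmetric] power2_eq_square)
  finally show ?thesis
    by (simp add: h_def)
qed

text \<open>The \<open>n + 1\<close> entries of the row sum to \<open>2 ^ n\<close>, and the middle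
  one is the largest.\<close>

lemma central_binomial_lower: "2 ^ n \<le> (n + 1) * real (n choose (n div 2))"
proof -
  have "(2::nat) ^ n = (\<Sum>k\<le>n. n choose k)"
    by (simp add: choose_row_sum)
  also have "\<dots> \<le> (\<Sum>k\<le>n. n choose (n div 2))"
    by (intro sum_mono binomial_maximum)
  finally have "(2::nat) ^ n \<le> (n + 1) * (n choose (n div 2))"
    by simp
  then have "real (2 ^ n) \<le> real ((n + 1) * (n choose (n div 2)))"
    by (rule of_nat_mono)
  then show ?thesis
    by (simp add: algebra_simps)
qed

text \<open>A single coefficient at distance about \<open>sqrt (n * ln n) / 2\<close> from the
  centre is already large enough. The exponent 8 is 6 from the exponential, as
  \<open>j\<^sup>2 \<le> n * ln n\<close>, plus 2 from bounding \<open>n + 1\<close> by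
  \<open>n ^ 2\<close> in the central estimate.\<close>

lemma binomial_tail_lower:
  obtains c :: real where "0 < c"
    "\<And>n::nat. 2 \<le> n \<Longrightarrow> \<exists>k\<le>n. sqrt (n * ln n) \<le> 2 * real k - n \<and> c / real n ^ 8 \<le> (n choose k) / 2 ^ n"
proof -
  \<comment> \<open>With \<open>r = sqrt (n * ln n)\<close>, the first condition gives
    \<open>j \<le> r\<close> despite rounding up, and the second then gives
    \<open>2 * j \<le> n div 2\<close>, its \<open>- 1\<close> paying for the floor.\<close>
  have "eventually (\<lambda>n::nat. sqrt (n * ln n) / 2 + 3/2 \<le> sqrt (n * ln n)) at_top"
    "eventually (\<lambda>n::nat. 2 * (sqrt (n * ln n)) \<le> n / 2 - 1) at_top"
    "eventually (\<lambda>n::nat. real n + 1 \<le> real n ^ 2) at_top"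
    by real_asymp+
  then have "eventually (\<lambda>n::nat. sqrt (n * ln n) / 2 + 3/2 \<le> sqrt (n * ln n)
      \<and> 2 * (sqrt (n * ln n)) \<le> n / 2 - 1 \<and> real n + 1 \<le> real n ^ 2) at_top"
    by eventually_elim simp
  then obtain n0 where n0: "\<And>n::nat. n \<ge> n0 \<Longrightarrow> sqrt (n * ln n) / 2 + 3/2 \<le> sqrt (n * ln n)
      \<and> 2 * (sqrt (n * ln n)) \<le> n / 2 - 1 \<and> real n + 1 \<le> real n ^ 2"
    unfolding eventually_at_top_linorder by blast
  define c :: real where "c = 1 / 2 ^ n0"
  show ?thesis
  proof
    show "0 < c" by (simp add: c_def)
    fix n :: nat assume n: "2 \<le> n"
    show "\<exists>k\<le>n. sqrt (n * ln n) \<le> 2 * real k - n \<and> c / real n ^ 8 \<le> (n choose k) / 2 ^ n"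
    proof (cases "n \<ge> n0")
      case False
      \<comment> \<open>For small \<open>n\<close> the choice \<open>k = n\<close> works: the
        coefficient is 1, and \<open>c = 1 / 2 ^ n0\<close> lies below
        \<open>1 / 2 ^ n\<close>.\<close>
      have "ln n \<le> real n"
        using ln_le_minus_one[of "real n"] n by simp
      then have "sqrt (n * ln n) \<le> sqrt (real n * n)"
        by (intro real_sqrt_le_mono mult_left_mono) auto
      moreover have "c / real n ^ 8 \<le> c / 1"
        using n by (intro divide_left_mono) (auto simp: c_def)
      moreover have "c \<le> 1 / 2 ^ n"
        unfolding c_def using False by (intro divide_left_mono power_increasing) auto
      ultimately show ?thesis
        by (intro exI[of _ n]) auto
    next
      case True
      define r where "r = sqrt (n * ln n)"
      \<comment> \<open>The summand 1 compensates for the floor in \<open>n div 2\<close>: with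
        \<open>k = n div 2 + j\<close>, \<open>2 * k - n \<ge> 2 * j - 1 \<ge> r\<close>.\<close>
      define j where "j = nat \<lceil>(r + 1) / 2\<rceil>"
      have r: "0 \<le> r" "r\<^sup>2 = n * ln n"
        using n by (auto simp: r_def)
      have nr: "r / 2 + 3/2 \<le> r" "2 * r \<le> n / 2 - 1" "real n + 1 \<le> real n ^ 2"
        using n0[OF True] by (auto simp: r_def)
      have j: "(r + 1) / 2 \<le> real j" "real j \<le> r / 2 + 3/2"
        using r of_int_ceiling_le_add_one[of "(r + 1) / 2"] unfolding j_def
        by (simp_all add: le_of_int_ceiling add_divide_distrib)
      have jh: "2 * j \<le> n div 2"
        using j nr by linarith
      have "exp (- 6 * ln n) \<le> exp (- 6 * (real j)\<^sup>2 / real n)"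
      proof -
        have "(real j)\<^sup>2 \<le> r\<^sup>2"
          using j nr by (intro power_mono) auto
        then show ?thesis
          using r n by (simp add: field_simps)
      qed
      also have "exp (- 6 * ln n) = 1 / real n ^ 6"
        using n exp_of_nat_mult[of 6 "ln (real n)"] by (simp add: exp_minus inverse_eq_divide)
      finally have e: "1 / real n ^ 6 \<le> exp (- 6 * (real j)\<^sup>2 / real n)" .
      have "c / real n ^ 8 \<le> 1 / real n ^ 8"
        by (intro divide_right_mono) (auto simp: c_def)
      also have "\<dots> = 1 / real n ^ 2 * (1 / real n ^ 6)"
        by (simp flip: power_add)
      also have "\<dots> \<le> real (n choose (n div 2)) / 2 ^ n * exp (- 6 * (real j)\<^sup>2 / real n)"
      proof (intro mult_mono e)
        have "2 ^ n \<le> real n ^ 2 * real (n choose (n div 2))"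
          using central_binomial_lower[of n] mult_right_mono[OF nr(3), of "real (n choose (n div 2))"]
          by linarith
        then show "1 / real n ^ 2 \<le> real (n choose (n div 2)) / 2 ^ n"
          using n by (simp add: field_simps)
      qed auto
      also have "\<dots> \<le> real (n choose (n div 2 + j)) / 2 ^ n"
        using binomial_step_lower[OF jh] n by (simp add: divide_right_mono)
      finally show ?thesis
        using j jh by (intro exI[of _ "n div 2 + j"]) (auto simp flip: r_def)
    qed
  qed
qed

section \<open>Convex combinations and vertices of zonotopes\<close>

text \<open>The mean of \<open>Suc k\<close> points is a two-point combination of the mean of the
  first \<open>k\<close> and the last point, so binary convexity suffices by induction.\<close>

lemma average_mem_convex_vecs:
  assumes "convex_vecs Q" "\<And>s. s < k \<Longrightarrow> x s \<in> Q" "\<And>s. s < k \<Longrightarrow> x s \<in> carrier_vec d" "0 < k"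
  shows "vec d (\<lambda>i. (\<Sum>s<k. x s $ i) / real k) \<in> Q"
  using assms(4,2,3)
proof (induction k rule: nat_induct_non_zero)
  case 1
  moreover have "vec d (\<lambda>i. (\<Sum>s<1. x s $ i) / real 1) = x 0"
    using 1 by (auto simp: lessThan_Suc)
  ultimately show ?case
    by simp
next
  case (Suc k)
  let ?a = "vec d (\<lambda>i. (\<Sum>s<k. x s $ i) / real k)"
  have "?a \<in> Q" "x k \<in> Q" "real k / real (Suc k) \<ge> 0" "1 / real (Suc k) \<ge> 0"
    "real k / real (Suc k) + 1 / real (Suc k) = 1"
    using Suc by (auto simp: add_divide_distrib[symmetric])
  then have "(real k / real (Suc k)) \<cdot>\<^sub>v ?a + (1 / real (Suc k)) \<cdot>\<^sub>v x k \<in> Q"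
    using assms(1) unfolding convex_vecs_def by blast
  also have "(real k / real (Suc k)) \<cdot>\<^sub>v ?a + (1 / real (Suc k)) \<cdot>\<^sub>v x k
      = vec d (\<lambda>i. (\<Sum>s<Suc k. x s $ i) / real (Suc k))"
    using Suc.prems(2)[of k] Suc.hyps by (intro eq_vecI) (auto simp: add_divide_distrib)
  finally show ?case .
qed

lemma convex_vecs_smult_mem:
  assumes "convex_vecs Q" "0\<^sub>v d \<in> Q" "x \<in> Q" "x \<in> carrier_vec d" "0 \<le> u" "u \<le> 1"
  shows "u \<cdot>\<^sub>v x \<in> Q"
proof -
  have "u \<cdot>\<^sub>v x + (1 - u) \<cdot>\<^sub>v 0\<^sub>v d \<in> Q"
    using assms unfolding convex_vecs_def by simp
  also have "u \<cdot>\<^sub>v x + (1 - u) \<cdot>\<^sub>v 0\<^sub>v d = u \<cdot>\<^sub>v x"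
    using assms(4) by auto
  finally show ?thesis .
qed

text \<open>Coordinates are freed one at a time: in the induction only those below \<open>j\<close>
  may be fractional. Coordinate \<open>j\<close> is split into its two extreme values with weights
  \<open>(1 + u $ j) / 2\<close> and \<open>(1 - u $ j) / 2\<close>. The contrapositive supplies a
  sign vector whose scaled image escapes \<open>Q\<close>.\<close>

lemma zonotope_subset_convexI:
  assumes W: "W \<in> carrier_mat d n" and Q: "convex_vecs Q"
    and vertices: "\<And>y. y \<in> sign_vecs n \<Longrightarrow> r \<cdot>\<^sub>v (W *\<^sub>v y) \<in> Q"
  shows "scale_set r (zonotope W) \<subseteq> Q"
proof -
  have "r \<cdot>\<^sub>v (W *\<^sub>v u) \<in> Q"
    if "u \<in> carrier_vec n" "\<forall>i<n. \<bar>u $ i\<bar> \<le> 1" "\<forall>i<n. j \<le> i \<longrightarrow> u $ i \<in> {-1, 1}" for u j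
    using that
  proof (induction j arbitrary: u)
    case 0
    then show ?case
      by (intro vertices) (auto simp: sign_vecs_def)
  next
    case (Suc j)
    show ?case
    proof (cases "j < n")
      case False
      then show ?thesis
        using Suc.prems by (intro Suc.IH) auto
    next
      case True
      define up where "up = (\<lambda>v. vec n (\<lambda>i. if i = j then v else u $ i))"
      define a where "a = (1 + u $ j) / 2"
      have a: "0 \<le> a" "0 \<le> 1 - a" "a + (1 - a) = 1"
        using Suc.prems(2) True by (force simp: a_def abs_le_iff)+
      have up: "up v \<in> carrier_vec n" for v
        by (simp add: up_def)
      have ue: "u = a \<cdot>\<^sub>v up 1 + (1 - a) \<cdot>\<^sub>v up (-1)"
        using Suc.prems(1) True
        by (intro eq_vecI) (auto simp: up_def a_def algebra_simps add_divide_distrib diff_divide_distrib)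
      have "r \<cdot>\<^sub>v (W *\<^sub>v up v) \<in> Q" if "v \<in> {-1, 1}" for v
        using Suc.prems that True by (intro Suc.IH) (auto simp: up_def not_less_eq_eq le_Suc_eq Suc_le_eq)
      then have "a \<cdot>\<^sub>v (r \<cdot>\<^sub>v (W *\<^sub>v up 1)) + (1 - a) \<cdot>\<^sub>v (r \<cdot>\<^sub>v (W *\<^sub>v up (-1))) \<in> Q"
        using Q a unfolding convex_vecs_def by blast
      also have "a \<cdot>\<^sub>v (r \<cdot>\<^sub>v (W *\<^sub>v up 1)) + (1 - a) \<cdot>\<^sub>v (r \<cdot>\<^sub>v (W *\<^sub>v up (-1))) = r \<cdot>\<^sub>v (W *\<^sub>v u)"
      proof -
        have "W *\<^sub>v u = a \<cdot>\<^sub>v (W *\<^sub>v up 1) + (1 - a) \<cdot>\<^sub>v (W *\<^sub>v up (-1))"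
          by (subst ue) (use W up in \<open>simp add: mult_add_distrib_mat_vec[OF W] mult_mat_vec[OF W]\<close>)
        then show ?thesis
          using W by (intro eq_vecI) (auto simp: algebra_simps)
      qed
      finally show ?thesis .
    qed
  qed
  from this[where j = n] show ?thesis
    using W by (auto simp: scale_set_def zonotope_def)
qed

section \<open>Counting escaping sign vectors by cyclic shifts\<close>

text \<open>Used in two ways: with the position fixed and the shift varying, to sum signs; with the
  shift fixed and the position varying, to recover a set from its translate.\<close>

lemma bij_betw_cyclic_shift:
  assumes "0 < n"
  shows "bij_betw (\<lambda>s. (j + s) mod n) {..<n} {..<n::nat}"
proof -
  have "inj_on (\<lambda>s. (j + s) mod n) {..<n}"
  proof (rule linorder_inj_onI)
    fix s t assume st: "s < t" "s \<in> {..<n}" "t \<in> {..<n}"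
    show "(j + s) mod n \<noteq> (j + t) mod n"
    proof
      assume "(j + s) mod n = (j + t) mod n"
      then have "n dvd (j + t) - (j + s)"
        using st(1) by (metis add_left_mono less_imp_le mod_eq_dvd_iff_nat)
      then show False
        using st by (auto dest: dvd_imp_le)
    qed
  qed auto
  moreover have "(\<lambda>s. (j + s) mod n) ` {..<n} \<subseteq> {..<n}"
    using assms by auto
  ultimately show ?thesis
    unfolding bij_betw_def using endo_inj_surj[of "{..<n}"] by blast
qed

text \<open>Every \<open>k\<close>-subset \<open>P\<close> has a shift \<open>s\<close> for which
  \<open>flip P s\<close> escapes, and \<open>P\<close> can be recovered from the pair
  \<open>(flip P s, s)\<close>. So there are at most as many \<open>k\<close>-subsets as pairs of an
  escaping sign vector and a shift.\<close>

lemma choose_le_bad_sign_vecs: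
  assumes W: "W \<in> carrier_mat d n" and n: "2 \<le> n"
    and Q: "convex_vecs Q" "0\<^sub>v d \<in> Q" "\<not> scale_set 2 (zonotope W) \<subseteq> Q"
    and k: "k \<le> n" "sqrt (n * ln n) \<le> 2 * real k - n"
  shows "n choose k \<le> n * card {y \<in> sign_vecs n. sample_point W y \<notin> Q}"
proof -
  obtain \<sigma> where \<sigma>: "\<sigma> \<in> sign_vecs n" and out: "2 \<cdot>\<^sub>v (W *\<^sub>v \<sigma>) \<notin> Q"
    using zonotope_subset_convexI[OF W Q(1)] Q(3) by blast
  have \<sigma>_carrier: "\<sigma> \<in> carrier_vec n"
    using \<sigma> by (simp add: sign_vecs_def)
  have \<sigma>_sign: "\<sigma> $ i = -1 \<or> \<sigma> $ i = 1" if "i < n" for i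
    using \<sigma> that by (auto simp: sign_vecs_def)
  define G where "G = {y \<in> sign_vecs n. sample_point W y \<notin> Q}"
  define \<epsilon> :: "nat set \<Rightarrow> nat \<Rightarrow> real" where "\<epsilon> = (\<lambda>P t. if t \<in> P then 1 else -1)"
  define flip where "flip = (\<lambda>P s. vec n (\<lambda>i. \<sigma> $ i * \<epsilon> P ((i + s) mod n)))"
  have flip_sign: "flip P s \<in> sign_vecs n" for P s
    using \<sigma>_sign by (fastforce simp: sign_vecs_def flip_def \<epsilon>_def)
  define r where "r = 2 * sqrt (n / ln n)"
  \<comment> \<open>The mean of \<open>\<epsilon> P\<close> over all positions, the same for every
    \<open>k\<close>-subset \<open>P\<close>.\<close>
  define \<mu> where "\<mu> = (2 * real k - n) / n"
  have ln: "0 < ln (real n)"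
    using n by simp
  \<comment> \<open>The sampling factor \<open>r\<close> is calibrated so that a sign surplus of
    exactly \<open>sqrt (n * ln n)\<close> brings the average to
    \<open>2 W \<sigma>\<close>.\<close>
  have "2 = r * (sqrt (n * ln n) / n)"
  proof -
    have "sqrt (n / ln n) * sqrt (n * ln n) = sqrt (real n * real n)"
      using ln by (simp flip: real_sqrt_mult)
    then show ?thesis
      using n by (simp add: r_def mult.assoc)
  qed
  also have "\<dots> \<le> r * \<mu>"
    unfolding \<mu>_def using ln k by (intro mult_left_mono divide_right_mono) (auto simp: r_def)
  finally have r\<mu>: "2 \<le> r * \<mu>" .
  have shift_out: "\<exists>s<n. flip P s \<in> G" if P: "P \<subseteq> {..<n}" "card P = k" for P
  proof (rule ccontr)
    assume "\<not> (\<exists>s<n. flip P s \<in> G)"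
    then have mem: "sample_point W (flip P s) \<in> Q" if "s < n" for s
      using that flip_sign by (auto simp: G_def)
    have sum_\<epsilon>: "(\<Sum>s<n. \<epsilon> P ((j + s) mod n)) = 2 * real k - n" for j
    proof -
      have "(\<Sum>s<n. \<epsilon> P ((j + s) mod n)) = (\<Sum>t<n. \<epsilon> P t)"
        using n by (intro sum.reindex_bij_betw bij_betw_cyclic_shift) simp
      also have "\<dots> = (\<Sum>t\<in>P. 1) + (\<Sum>t\<in>{..<n} - P. - 1)"
        using P(1) by (subst sum.subset_diff[of P]) (auto simp: \<epsilon>_def)
      also have "\<dots> = 2 * real k - n"
        using P k(1) by (simp add: card_Diff_subset finite_subset of_nat_diff)
      finally show ?thesis .
    qed
    let ?avg = "vec d (\<lambda>i. (\<Sum>s<n. sample_point W (flip P s) $ i) / real n)"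
    have "?avg = (r * \<mu>) \<cdot>\<^sub>v (W *\<^sub>v \<sigma>)"
    proof (rule eq_vecI)
      fix i assume "i < dim_vec ((r * \<mu>) \<cdot>\<^sub>v (W *\<^sub>v \<sigma>))"
      then have i: "i < d"
        using W by simp
      have "(\<Sum>s<n. sample_point W (flip P s) $ i)
          = (\<Sum>s<n. \<Sum>j<n. r * (W $$ (i, j) * \<sigma> $ j) * \<epsilon> P ((j + s) mod n))"
        using W i by (intro sum.cong)
          (auto simp: sample_point_def r_def scalar_prod_def flip_def sum_distrib_left lessThan_atLeast0 mult_ac intro!: sum.cong)
      \<comment> \<open>After swapping the sums, the sum over shifts does not depend on
        \<open>j\<close>, so it factors out and leaves a multiple of
        \<open>W \<sigma>\<close>.\<close>
      also have "\<dots> = (\<Sum>j<n. r * (W $$ (i, j) * \<sigma> $ j) * (2 * real k - n))"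
        by (subst sum.swap) (simp add: sum_\<epsilon> flip: sum_distrib_left)
      also have "\<dots> = r * (2 * real k - n) * (W *\<^sub>v \<sigma>) $ i"
        using W i \<sigma>_carrier
        by (auto simp: scalar_prod_def sum_distrib_left lessThan_atLeast0 mult_ac intro!: sum.cong)
      finally show "?avg $ i = ((r * \<mu>) \<cdot>\<^sub>v (W *\<^sub>v \<sigma>)) $ i"
        using W i by (simp add: \<mu>_def)
    qed (use W in simp)
    moreover have "?avg \<in> Q"
      using mem W n by (intro average_mem_convex_vecs[OF Q(1)])
        (auto simp: sample_point_def flip_def intro!: carrier_vecI)
    \<comment> \<open>Shrinking the average towards the origin by
      \<open>2 / (r * \<mu>) \<le> 1\<close> would put \<open>2 W \<sigma>\<close> into
      \<open>Q\<close>.\<close>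
    ultimately have "(2 / (r * \<mu>)) \<cdot>\<^sub>v ((r * \<mu>) \<cdot>\<^sub>v (W *\<^sub>v \<sigma>)) \<in> Q"
      using r\<mu> W \<sigma>_carrier
      by (intro convex_vecs_smult_mem[OF Q(1,2), of "(r * \<mu>) \<cdot>\<^sub>v (W *\<^sub>v \<sigma>)"]) auto
    moreover have "2 / (r * \<mu>) * (r * \<mu>) = 2"
      using r\<mu> by (intro nonzero_eq_divide_eq[THEN iffD1, OF _ refl]) auto
    ultimately show False
      using out by (simp only: smult_smult_assoc)
  qed
  \<comment> \<open>The positions where \<open>y\<close> agrees with \<open>\<sigma>\<close>,
    translated by \<open>s\<close>; this undoes \<open>flip\<close>.\<close>
  define decode where "decode = (\<lambda>(y, s). (\<lambda>i. (i + s) mod n) ` {i \<in> {..<n}. y $ i * \<sigma> $ i = 1})"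
  have "{P. P \<subseteq> {..<n} \<and> card P = k} \<subseteq> decode ` (G \<times> {..<n})"
  proof
    fix P assume "P \<in> {P. P \<subseteq> {..<n} \<and> card P = k}"
    then have P: "P \<subseteq> {..<n}" "card P = k"
      by auto
    then obtain s where s: "s < n" "flip P s \<in> G"
      using shift_out by blast
    have "flip P s $ i * \<sigma> $ i = 1 \<longleftrightarrow> (i + s) mod n \<in> P" if "i < n" for i
      using \<sigma>_sign[OF that] that by (auto simp: flip_def \<epsilon>_def)
    then have "decode (flip P s, s) = (\<lambda>i. (s + i) mod n) ` {i \<in> {..<n}. (s + i) mod n \<in> P}"
      by (auto simp: decode_def add.commute)
    also have "\<dots> = (\<lambda>i. (s + i) mod n) ` {..<n} \<inter> P"
      by blast
    also have "\<dots> = P"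
      using bij_betw_imp_surj_on[OF bij_betw_cyclic_shift[of n s]] n P(1) by auto
    finally show "P \<in> decode ` (G \<times> {..<n})"
      using s by (intro image_eqI[of _ _ "(flip P s, s)"]) auto
  qed
  moreover have "finite (G \<times> {..<n})"
    using finite_sign_vecs[of n] by (simp add: G_def)
  ultimately have "card {P. P \<subseteq> {..<n} \<and> card P = k} \<le> card (G \<times> {..<n})"
    by (rule surj_card_le[rotated])
  then show ?thesis
    by (simp add: n_subsets card_cartesian_product G_def mult.commute)
qed

section \<open>Probabilities of the sampling loop\<close>

lemma card_sign_vecs_le: "card (sign_vecs n) \<le> 2 ^ n"
proof -
  have "sign_vecs n \<subseteq> vec n ` ({..<n} \<rightarrow>\<^sub>E {-1, 1})"
  proof
    fix y assume "y \<in> sign_vecs n"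
    then have "y = vec n (restrict (($) y) {..<n})" "restrict (($) y) {..<n} \<in> {..<n} \<rightarrow>\<^sub>E {-1, 1}"
      by (auto simp: sign_vecs_def)
    then show "y \<in> vec n ` ({..<n} \<rightarrow>\<^sub>E {-1, 1})"
      by (rule image_eqI)
  qed
  then have "card (sign_vecs n) \<le> card ({..<n} \<rightarrow>\<^sub>E {-1, 1 :: real})"
    by (intro surj_card_le) (auto intro: finite_PiE)
  then show ?thesis
    by (simp add: card_PiE numeral_2_eq_2)
qed

definition miss_prob :: "(real vec \<Rightarrow> bool) \<Rightarrow> real mat \<Rightarrow> real" where
  "miss_prob mem W =
     measure_pmf.prob (pmf_of_set (sign_vecs (dim_col W))) {y. mem (sample_point W y)}"

text \<open>The draws are independent, and \<open>Yes\<close> requires every one of them to be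
  accepted by the oracle.\<close>

lemma pmf_sampling_loop_Yes: "pmf (sampling_loop mem W T) Yes = miss_prob mem W ^ T"
proof (induction T)
  case (Suc T)
  have "pmf (sampling_loop mem W (Suc T)) Yes
      = (\<integral>y. indicator {y. mem (sample_point W y)} y * miss_prob mem W ^ T
           \<partial>pmf_of_set (sign_vecs (dim_col W)))"
    unfolding sampling_loop.simps pmf_bind
    by (intro Bochner_Integration.integral_cong) (auto simp: Let_def Suc.IH indicator_def)
  then show ?case
    by (simp add: miss_prob_def)
qed simp

text \<open>The error is one-sided: a \<open>No\<close> always carries a rejected sample
  point.\<close>

lemma set_pmf_sampling_loop:
  "set_pmf (sampling_loop mem W T)
    \<subseteq> insert Yes (No ` {x \<in> sample_point W ` sign_vecs (dim_col W). \<not> mem x})"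
proof (induction T)
  case (Suc T)
  then show ?case
    by (auto simp: Let_def set_pmf_of_set[OF sign_vecs_nonempty finite_sign_vecs] split: if_splits)
qed simp

text \<open>A union bound over two random stages: \<open>a * (1 - q) \<ge> a - q\<close> for a
  probability \<open>a\<close>. If \<open>q > 1\<close>, the left side is negative.\<close>

lemma prob_bind_pmf_ge:
  assumes "\<And>x. x \<in> A \<Longrightarrow> 1 - q \<le> measure_pmf.prob (f x) E" "0 \<le> q"
  shows "measure_pmf.prob M A - q \<le> measure_pmf.prob (bind_pmf M f) E"
proof (cases "q \<le> 1")
  case True
  have "ennreal (measure_pmf.prob M A * (1 - q)) = (\<integral>\<^sup>+x. ennreal (1 - q) * indicator A x \<partial>M)"
    using True by (subst nn_integral_cmult_indicator) (simp_all add: measure_pmf.emeasure_eq_measure ennreal_mult mult.commute)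
  also have "\<dots> \<le> (\<integral>\<^sup>+x. emeasure (f x) E \<partial>M)"
    using assms(1) by (intro nn_integral_mono)
      (auto simp: indicator_def measure_pmf.emeasure_eq_measure intro!: ennreal_leI)
  also have "\<dots> = ennreal (measure_pmf.prob (bind_pmf M f) E)"
    by (simp flip: measure_pmf.emeasure_eq_measure)
  finally have "measure_pmf.prob M A * (1 - q) \<le> measure_pmf.prob (bind_pmf M f) E"
    by simp
  moreover have "measure_pmf.prob M A * q \<le> q"
    using assms(2) by (simp add: mult_left_le_one_le)
  ultimately show ?thesis
    by (simp add: algebra_simps)
next
  case False
  then show ?thesis
    using measure_pmf.prob_le_1[of M A] measure_nonneg[of "bind_pmf M f" E] by linarith
qed

text \<open>The division of \<open>p\<close> by \<open>n\<close> reflects the \<open>n\<close>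
  shifts in the counting bound.\<close>

lemma miss_prob_le:
  assumes W: "W \<in> carrier_mat d n" and n: "2 \<le> n"
    and Q: "convex_vecs Q" "0\<^sub>v d \<in> Q" "\<not> scale_set 2 (zonotope W) \<subseteq> Q"
    and k: "k \<le> n" "sqrt (n * ln n) \<le> 2 * real k - n" "p \<le> (n choose k) / 2 ^ n"
  shows "miss_prob (\<lambda>x. x \<in> Q) W \<le> 1 - p / n"
proof -
  let ?S = "pmf_of_set (sign_vecs n)" and ?G = "{y \<in> sign_vecs n. sample_point W y \<notin> Q}"
  have pos: "0 < card (sign_vecs n)"
    by (simp add: card_gt_0_iff finite_sign_vecs sign_vecs_nonempty)
  have "p / n \<le> (n choose k) / 2 ^ n / n"
    using k(3) by (rule divide_right_mono) simp
  also have "\<dots> \<le> (n * card ?G) / 2 ^ n / n"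
    using choose_le_bad_sign_vecs[OF W n Q k(1,2)]
    by (intro divide_right_mono) (auto simp flip: of_nat_mult)
  also have "\<dots> = card ?G / 2 ^ n"
    using n by simp
  also have "\<dots> \<le> card ?G / card (sign_vecs n)"
    using pos of_nat_mono[OF card_sign_vecs_le[of n], where ?'a = real]
    by (intro divide_left_mono) auto
  also have "\<dots> = measure_pmf.prob ?S {y. sample_point W y \<notin> Q}"
    by (simp add: measure_pmf_of_set[OF sign_vecs_nonempty finite_sign_vecs] Int_def)
  also have "\<dots> = 1 - measure_pmf.prob ?S {y. sample_point W y \<in> Q}"
    using measure_pmf.prob_compl[of "{y. sample_point W y \<in> Q}" ?S] by (simp add: Compl_eq_Diff_UNIV[symmetric] Collect_neg_eq)
  finally show ?thesis
    using W by (simp add: miss_prob_def)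
qed

section \<open>Scaled zonotopes and correctness of the loop\<close>

lemma sample_point_mem_scale_zonotope:
  assumes W: "W \<in> carrier_mat d n" and y: "y \<in> sign_vecs n" and s: "2 * sqrt (n / ln n) \<le> s" "0 < s"
    and n: "1 \<le> n"
  shows "sample_point W y \<in> scale_set s (zonotope W)"
proof -
  define r where "r = 2 * sqrt (n / ln n)"
  \<comment> \<open>For \<open>n = 1\<close> the quotient by \<open>ln 1 = 0\<close> is 0, so
    \<open>r = 0\<close>.\<close>
  have "0 \<le> r"
    using n by (simp add: r_def)
  then have "\<bar>((r / s) \<cdot>\<^sub>v y) $ i\<bar> \<le> 1" if "i < n" for i
    using y s that by (auto simp: sign_vecs_def r_def[symmetric] abs_mult)
  moreover have yc: "y \<in> carrier_vec n"
    using y by (simp add: sign_vecs_def)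
  ultimately have "W *\<^sub>v ((r / s) \<cdot>\<^sub>v y) \<in> zonotope W"
    using W by (auto simp: zonotope_def)
  moreover have "sample_point W y = s \<cdot>\<^sub>v (W *\<^sub>v ((r / s) \<cdot>\<^sub>v y))"
    using W yc s by (simp add: sample_point_def r_def mult_mat_vec smult_smult_assoc)
  ultimately show ?thesis
    unfolding scale_set_def by blast
qed

lemma zonotope_subset_scale_set:
  assumes "1 \<le> s"
  shows "zonotope W \<subseteq> scale_set s (zonotope W)"
proof
  fix z assume "z \<in> zonotope W"
  then obtain x where x: "x \<in> carrier_vec (dim_col W)" "\<forall>i<dim_col W. \<bar>x $ i\<bar> \<le> 1" "z = W *\<^sub>v x"
    by (auto simp: zonotope_def)
  have "\<bar>((1 / s) \<cdot>\<^sub>v x) $ i\<bar> \<le> 1" if "i < dim_col W" for i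
    using x that assms by (auto simp: abs_mult field_simps intro: order_trans[of _ 1])
  then have "W *\<^sub>v ((1 / s) \<cdot>\<^sub>v x) \<in> zonotope W"
    using x by (auto simp: zonotope_def)
  moreover have "z = s \<cdot>\<^sub>v (W *\<^sub>v ((1 / s) \<cdot>\<^sub>v x))"
    using x assms by (simp add: mult_mat_vec[of W "dim_row W" "dim_col W"] smult_smult_assoc)
  ultimately show "z \<in> scale_set s (zonotope W)"
    unfolding scale_set_def by blast
qed

lemma prob_sampling_loop_No:
  "1 - miss_prob mem W ^ T \<le> measure_pmf.prob (sampling_loop mem W T)
     {a. \<exists>x \<in> sample_point W ` sign_vecs (dim_col W). \<not> mem x \<and> a = No x}"
proof -
  let ?L = "sampling_loop mem W T"
  have "1 - miss_prob mem W ^ T = 1 - measure_pmf.prob ?L {Yes}"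
    by (simp add: measure_pmf_single pmf_sampling_loop_Yes)
  also have "\<dots> = measure_pmf.prob ?L (- {Yes})"
    using measure_pmf.prob_compl[of "{Yes}" ?L] by (simp add: Compl_eq_Diff_UNIV)
  also have "\<dots> = measure_pmf.prob ?L (- {Yes} \<inter> set_pmf ?L)"
    by (simp add: measure_Int_set_pmf)
  also have "\<dots> \<le> measure_pmf.prob ?L
      {a. \<exists>x \<in> sample_point W ` sign_vecs (dim_col W). \<not> mem x \<and> a = No x}"
    using set_pmf_sampling_loop[of mem W T] by (intro measure_pmf.finite_measure_mono) auto
  finally show ?thesis .
qed

text \<open>If \<open>zonotope V\<close> is not inside \<open>Q\<close>, then neither is its
  \<open>s\<close>-fold multiple, as \<open>s \<ge> 1\<close>, so \<open>No\<close> is the required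
  answer. If the multiple lies inside \<open>Q\<close>, no sample can escape and the answer is
  surely \<open>Yes\<close>. In between, any answer is accepted.\<close>

lemma sampling_loop_correct:
  assumes sp: "is_sparsification d N V W"
    and s: "1 \<le> s" "2 * sqrt (dim_col W / ln (dim_col W)) \<le> s"
    and q: "\<not> zonotope V \<subseteq> Q \<Longrightarrow> miss_prob (\<lambda>x. x \<in> Q) W ^ T \<le> q" "0 \<le> q"
  defines "L \<equiv> sampling_loop (\<lambda>x. x \<in> Q) W T"
  shows "\<not> zonotope V \<subseteq> Q \<Longrightarrow>
      1 - q \<le> measure_pmf.prob L {a. \<exists>x \<in> scale_set s (zonotope V) - Q. a = No x}" (is "_ \<Longrightarrow> ?A")
    and "1 - q \<le> measure_pmf.prob L {a. solves_gap_containment s (zonotope V) Q a}" (is ?B)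
proof -
  have sub: "sample_point W ` sign_vecs (dim_col W) \<subseteq> scale_set s (zonotope V)"
  proof -
    have "sample_point W y \<in> scale_set s (zonotope W)" if "y \<in> sign_vecs (dim_col W)" for y
      using that sp s by (intro sample_point_mem_scale_zonotope[where d = d]) (auto simp: is_sparsification_def)
    moreover have "scale_set s (zonotope W) \<subseteq> scale_set s (zonotope V)"
      using sp unfolding is_sparsification_def scale_set_def by (intro image_mono) simp
    ultimately show ?thesis
      by blast
  qed
  show A: ?A if "\<not> zonotope V \<subseteq> Q"
  proof -
    have "1 - q \<le> 1 - miss_prob (\<lambda>x. x \<in> Q) W ^ T"
      using q(1) that by simp
    also have "\<dots> \<le> measure_pmf.prob L
        {a. \<exists>x \<in> sample_point W ` sign_vecs (dim_col W). x \<notin> Q \<and> a = No x}"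
      unfolding L_def by (rule prob_sampling_loop_No)
    also have "\<dots> \<le> measure_pmf.prob L {a. \<exists>x \<in> scale_set s (zonotope V) - Q. a = No x}"
      using sub by (intro measure_pmf.finite_measure_mono) auto
    finally show ?thesis .
  qed
  note grow = zonotope_subset_scale_set[OF s(1), of V]
  show ?B
  proof (cases "zonotope V \<subseteq> Q")
    case False
    then have "{a. \<exists>x \<in> scale_set s (zonotope V) - Q. a = No x}
        \<subseteq> {a. solves_gap_containment s (zonotope V) Q a}"
      using grow by (auto simp: solves_gap_containment_def)
    then have "measure_pmf.prob L {a. \<exists>x \<in> scale_set s (zonotope V) - Q. a = No x}
        \<le> measure_pmf.prob L {a. solves_gap_containment s (zonotope V) Q a}"
      by (intro measure_pmf.finite_measure_mono) auto
    then show ?thesis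
      using A[OF False] by linarith
  next
    case True
    have "set_pmf L \<subseteq> {Yes}" if "scale_set s (zonotope V) \<subseteq> Q"
      using set_pmf_sampling_loop[of "\<lambda>x. x \<in> Q" W T] sub that by (auto simp: L_def)
    then have "set_pmf L \<subseteq> {a. solves_gap_containment s (zonotope V) Q a}"
      using True by (auto simp: solves_gap_containment_def)
    then have "measure_pmf.prob L {a. solves_gap_containment s (zonotope V) Q a} = 1"
      by (subst measure_pmf.prob_eq_1) (auto simp: AE_measure_pmf_iff)
    then show ?thesis
      using q(2) by simp
  qed
qed

section \<open>Choice of parameters and the final estimate\<close>

text \<open>For \<open>n > d\<close>, \<open>ln n \<ge> ln d\<close> cancels the logarithm in the
  bound on \<open>n\<close>; for \<open>n \<le> d\<close>, \<open>ln n \<ge> ln 2\<close> is enough.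
  The slack \<open>1 +\<close> makes the bound usable as a gap factor that is at least 1 for every
  \<open>d\<close>.\<close>

lemma scaling_factor_le:
  assumes n: "2 \<le> n" "real n \<le> A * (real d * ln d)" and d: "2 \<le> d" and A: "0 < A"
  shows "2 * sqrt (n / ln n) \<le> 1 + 2 * sqrt (max A (1 / ln 2)) * sqrt d"
proof -
  have lnn: "ln 2 \<le> ln (real n)" and lnd: "0 < ln (real d)"
    using n d by simp_all
  have "n / ln n \<le> max A (1 / ln 2) * d"
  proof (cases "n \<le> d")
    case True
    then have "n / ln n \<le> d / ln 2"
      using lnn by (intro frac_le) auto
    also have "\<dots> \<le> max A (1 / ln 2) * d"
      by (subst divide_inverse, subst mult.commute) (intro mult_right_mono, auto simp: inverse_eq_divide)
    finally show ?thesis .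
  next
    case False
    then have "n / ln n \<le> A * (real d * ln d) / ln d"
      using n lnd d by (intro frac_le) auto
    also have "\<dots> = A * d"
      using lnd by simp
    also have "\<dots> \<le> max A (1 / ln 2) * d"
      by (intro mult_right_mono) auto
    finally show ?thesis .
  qed
  then have "sqrt (n / ln n) \<le> sqrt (max A (1 / ln 2) * d)"
    by (rule real_sqrt_le_mono)
  then show ?thesis
    by (simp add: real_sqrt_mult)
qed

lemma power_one_minus_le_exp:
  fixes x p :: real
  assumes "0 \<le> x" "x \<le> 1 - p"
  shows "x ^ T \<le> exp (- (p * T))"
proof -
  have "x ^ T \<le> exp (- p) ^ T"
    using assms exp_ge_add_one_self[of "- p"] by (intro power_mono) auto
  then show ?thesis
    by (simp add: mult.commute flip: exp_of_nat_mult)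
qed

theorem theorem2p5:
  shows "\<exists>C :: nat. \<forall>c>0. \<forall>(N :: nat \<Rightarrow> nat) (S :: real mat \<Rightarrow> real mat pmf).
    zonotope_sparsifier c N S \<longrightarrow>
    (\<exists>(s :: nat \<Rightarrow> real) (\<delta> :: nat \<Rightarrow> real).
       s \<in> O(\<lambda>d. sqrt (real d)) \<and> (\<forall>d. s d \<ge> 1) \<and>
       \<delta> \<in> O(\<lambda>d. real d powr (- c)) \<and>
       (\<forall>d>0. \<forall>m. \<forall>V\<in>carrier_mat d m. \<forall>Q T.
          convex_body d Q \<and> centered d Q \<and> T \<ge> d ^ (2 * C) \<longrightarrow>
            (\<not> zonotope V \<subseteq> Q \<longrightarrow>
               measure_pmf.prob (hypercube_sampling S (\<lambda>x. x \<in> Q) V T)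
                 {a. \<exists>x \<in> scale_set (s d) (zonotope V) - Q. a = No x} \<ge> 1 - \<delta> d) \<and>
            measure_pmf.prob (hypercube_sampling S (\<lambda>x. x \<in> Q) V T)
              {a. solves_gap_containment (s d) (zonotope V) Q a} \<ge> 1 - \<delta> d))"
proof -
  obtain c\<^sub>0 :: real where c\<^sub>0: "0 < c\<^sub>0" and tail: "\<And>n::nat. 2 \<le> n \<Longrightarrow>
      \<exists>k\<le>n. sqrt (n * ln n) \<le> 2 * real k - n \<and> c\<^sub>0 / real n ^ 8 \<le> (n choose k) / 2 ^ n"
    using binomial_tail_lower by blast
  show ?thesis
  \<comment> \<open>Each draw escapes with probability at least \<open>c\<^sub>0 / n ^ 9\<close>,
    where 9 is the tail exponent 8 plus 1 for the shifts. As \<open>n \<le> d ^ 2\<close> for large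
    \<open>d\<close>, \<open>d ^ 20\<close> draws exceed \<open>n ^ 9\<close> by a factor of
    \<open>d ^ 2\<close>.\<close>
  proof (rule exI[of _ 10], intro allI impI)
    fix c :: real and N :: "nat \<Rightarrow> nat" and S :: "real mat \<Rightarrow> real mat pmf"
    assume c: "0 < c" and sparsifier: "zonotope_sparsifier c N S"
    from sparsifier have "(\<lambda>d. real (N d)) \<in> O(\<lambda>d. real d * ln (real d))"
      by (simp add: zonotope_sparsifier_def)
    then obtain A where A: "0 < A"
      "eventually (\<lambda>d. norm (real (N d)) \<le> A * norm (real d * ln (real d))) at_top"
      by (rule landau_o.bigE)
    from sparsifier obtain \<delta>\<^sub>0 :: "nat \<Rightarrow> real" where \<delta>\<^sub>0: "\<delta>\<^sub>0 \<in> O(\<lambda>d. real d powr (- c))"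
      "\<And>d m V. 0 < d \<Longrightarrow> V \<in> carrier_mat d m \<Longrightarrow>
         1 - \<delta>\<^sub>0 d \<le> measure_pmf.prob (S V) {W. is_sparsification d (N d) V W}"
      unfolding zonotope_sparsifier_def by blast
    have "eventually (\<lambda>d::nat. 2 \<le> d) at_top" "eventually (\<lambda>d::nat. A * (real d * ln d) \<le> real d ^ 2) at_top"
      using A(1) by real_asymp+
    with A(2) have "eventually (\<lambda>d. 2 \<le> d \<and> real (N d) \<le> A * (real d * ln d) \<and> A * (real d * ln d) \<le> real d ^ 2) at_top"
      by eventually_elim auto
    then obtain d\<^sub>0 where d\<^sub>0: "\<And>d. d\<^sub>0 \<le> d \<Longrightarrow>
        2 \<le> d \<and> real (N d) \<le> A * (real d * ln d) \<and> A * (real d * ln d) \<le> real d ^ 2"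
      unfolding eventually_at_top_linorder by blast
    define B where "B = max A (1 / ln 2)"
    define s :: "nat \<Rightarrow> real" where "s = (\<lambda>d. 1 + 2 * sqrt B * sqrt d)"
    \<comment> \<open>The failure bound for the loop alone. It decays faster than every power of
      \<open>d\<close>, so \<open>C\<close> can be fixed before \<open>c\<close>.\<close>
    define q :: "nat \<Rightarrow> real" where "q = (\<lambda>d. exp (- (c\<^sub>0 * real d ^ 2)))"
    \<comment> \<open>Below \<open>d\<^sub>0\<close> the value 1 makes the claim trivial without
      affecting the asymptotics.\<close>
    define \<delta> where "\<delta> d = (if d\<^sub>0 \<le> d then \<delta>\<^sub>0 d + q d else 1)" for d
    have B: "0 < B"
      using A(1) by (simp add: B_def)
    have s_bigo: "s \<in> O(\<lambda>d. sqrt (real d))"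
      unfolding s_def using B by real_asymp
    have s1: "1 \<le> s d" for d
      using B by (simp add: s_def)
    have \<delta>_bigo: "\<delta> \<in> O(\<lambda>d. real d powr (- c))"
    proof -
      have "q \<in> O(\<lambda>d. real d powr (- c))"
        unfolding q_def using c c\<^sub>0 by real_asymp
      with \<delta>\<^sub>0(1) have "(\<lambda>d. \<delta>\<^sub>0 d + q d) \<in> O(\<lambda>d. real d powr (- c))"
        by (rule sum_in_bigo)
      moreover have ev: "eventually (\<lambda>d. \<delta> d = \<delta>\<^sub>0 d + q d) at_top"
        using eventually_ge_at_top[of d\<^sub>0] by eventually_elim (simp add: \<delta>_def)
      ultimately show ?thesis
        by (simp only: landau_o.big.in_cong[OF ev])
    qed
    have main: "(\<not> zonotope V \<subseteq> Q \<longrightarrow> 1 - \<delta> d \<le> measure_pmf.prob (hypercube_sampling S (\<lambda>x. x \<in> Q) V T)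
                {a. \<exists>x \<in> scale_set (s d) (zonotope V) - Q. a = No x}) \<and>
        1 - \<delta> d \<le> measure_pmf.prob (hypercube_sampling S (\<lambda>x. x \<in> Q) V T)
              {a. solves_gap_containment (s d) (zonotope V) Q a}"
      if d: "0 < d" and V: "V \<in> carrier_mat d m" and Q: "convex_body d Q" "centered d Q"
        and T: "d ^ (2 * 10) \<le> T" for d m V Q T
    proof (cases "d\<^sub>0 \<le> d")
      case False
      then show ?thesis
        by (simp add: \<delta>_def)
    next
      case True
      have convex: "convex_vecs Q" and zero: "0\<^sub>v d \<in> Q"
        using Q interior_of_subset[of "euclid_top d" Q] by (auto simp: convex_body_def centered_def)
      have good: "2 * sqrt (dim_col W / ln (dim_col W)) \<le> s d"
        "\<not> zonotope V \<subseteq> Q \<Longrightarrow> miss_prob (\<lambda>x. x \<in> Q) W ^ T \<le> q d"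
        if sp: "is_sparsification d (N d) V W" for W
      proof -
        define n where "n = dim_col W"
        have n: "2 \<le> n" "n \<le> N d" and W: "W \<in> carrier_mat d n"
          using sp by (auto simp: is_sparsification_def n_def)
        have n_le: "real n \<le> A * (real d * ln d)" "real n \<le> real d ^ 2"
          using n(2) d\<^sub>0[OF True] by linarith+
        show "2 * sqrt (dim_col W / ln (dim_col W)) \<le> s d"
          using scaling_factor_le[OF n(1) n_le(1) _ A(1)] d\<^sub>0[OF True] by (simp add: s_def n_def B_def)
        assume "\<not> zonotope V \<subseteq> Q"
        \<comment> \<open>The outer inclusion of the sparsification is what the factor 2 in
          \<open>sample_point\<close> pays for.\<close>
        then have escapes: "\<not> scale_set 2 (zonotope W) \<subseteq> Q"
          using sp by (auto simp: is_sparsification_def)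
        obtain k where "k \<le> n" "sqrt (n * ln n) \<le> 2 * real k - n" "c\<^sub>0 / real n ^ 8 \<le> (n choose k) / 2 ^ n"
          using tail[OF n(1)] by blast
        from miss_prob_le[OF W n(1) convex zero escapes this]
        have "miss_prob (\<lambda>x. x \<in> Q) W \<le> 1 - c\<^sub>0 / real n ^ 9"
          using power_add[of "real n" 8 1] by simp
        then have "miss_prob (\<lambda>x. x \<in> Q) W ^ T \<le> exp (- (c\<^sub>0 / real n ^ 9 * T))"
          by (intro power_one_minus_le_exp) (simp_all add: miss_prob_def)
        also have "\<dots> \<le> q d"
        proof -
          have "real d ^ 2 * real n ^ 9 \<le> real d ^ 2 * (real d ^ 2) ^ 9"
            using n_le(2) by (intro mult_left_mono power_mono) auto
          also have "\<dots> = real d ^ (2 * 10)"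
            by (simp flip: power_mult power_add)
          also have "\<dots> \<le> T"
            using T by (metis of_nat_le_iff of_nat_power)
          finally have "real d ^ 2 \<le> T / real n ^ 9"
            using n(1) by (simp add: field_simps)
          then have "c\<^sub>0 * real d ^ 2 \<le> c\<^sub>0 * (T / real n ^ 9)"
            using c\<^sub>0 by (intro mult_left_mono) auto
          then show ?thesis
            by (simp add: q_def)
        qed
        finally show "miss_prob (\<lambda>x. x \<in> Q) W ^ T \<le> q d" .
      qed
      have q0: "0 \<le> q d"
        by (simp add: q_def)
      have bind: "1 - \<delta> d \<le> measure_pmf.prob (hypercube_sampling S (\<lambda>x. x \<in> Q) V T) E"
        if "\<And>W. is_sparsification d (N d) V W \<Longrightarrow>
          1 - q d \<le> measure_pmf.prob (sampling_loop (\<lambda>x. x \<in> Q) W T) E" for E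
      proof -
        have "1 - \<delta> d \<le> measure_pmf.prob (S V) {W. is_sparsification d (N d) V W} - q d"
          using \<delta>\<^sub>0(2)[OF d V] True by (simp add: \<delta>_def)
        also have "\<dots> \<le> measure_pmf.prob (hypercube_sampling S (\<lambda>x. x \<in> Q) V T) E"
          unfolding hypercube_sampling_def using that q0 by (intro prob_bind_pmf_ge) auto
        finally show ?thesis .
      qed
      show ?thesis
      proof (intro conjI impI bind)
        fix W assume sp: "is_sparsification d (N d) V W"
        note correct = sampling_loop_correct[OF sp s1 good(1)[OF sp] good(2)[OF sp] q0]
        show "1 - q d \<le> measure_pmf.prob (sampling_loop (\<lambda>x. x \<in> Q) W T)
            {a. \<exists>x \<in> scale_set (s d) (zonotope V) - Q. a = No x}" if "\<not> zonotope V \<subseteq> Q"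
          using correct(1) that by simp
        show "1 - q d \<le> measure_pmf.prob (sampling_loop (\<lambda>x. x \<in> Q) W T)
            {a. solves_gap_containment (s d) (zonotope V) Q a}"
          using correct(2) by simp
      qed
    qed
    show "\<exists>(s :: nat \<Rightarrow> real) (\<delta> :: nat \<Rightarrow> real).
       s \<in> O(\<lambda>d. sqrt (real d)) \<and> (\<forall>d. s d \<ge> 1) \<and>
       \<delta> \<in> O(\<lambda>d. real d powr (- c)) \<and>
       (\<forall>d>0. \<forall>m. \<forall>V\<in>carrier_mat d m. \<forall>Q T.
          convex_body d Q \<and> centered d Q \<and> T \<ge> d ^ (2 * 10) \<longrightarrow>
            (\<not> zonotope V \<subseteq> Q \<longrightarrow>
               measure_pmf.prob (hypercube_sampling S (\<lambda>x. x \<in> Q) V T)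
                 {a. \<exists>x \<in> scale_set (s d) (zonotope V) - Q. a = No x} \<ge> 1 - \<delta> d) \<and>
            measure_pmf.prob (hypercube_sampling S (\<lambda>x. x \<in> Q) V T)
              {a. solves_gap_containment (s d) (zonotope V) Q a} \<ge> 1 - \<delta> d)"
    proof (rule exI[of _ s], rule exI[of _ \<delta>], intro conjI)
      show "s \<in> O(\<lambda>d. sqrt (real d))" "\<forall>d. s d \<ge> 1" "\<delta> \<in> O(\<lambda>d. real d powr (- c))"
        using s_bigo s1 \<delta>_bigo by auto
    qed (intro allI ballI impI, elim conjE, rule main)
  qed
qed

end
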